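(* Let $p_i$ denote the $i$-th prime and, for $n\ge1$, let $$B_n=\prod_{i=1}^{n}p_i^{\lfloor n/i\rfloor}=2^{n}\,3^{\lfloor n/2\rfloor}\,5^{\lfloor n/3\rfloor}\cdots p_n^{\lfloor n/n\rfloor}.$$ Then the sequence $(B_n)_{n\ge1}$ contains only finitely many highly composite numbers.
   Context: A positive integer $N$ is highly composite if $d(m)<d(N)$ for every positive integer $m<N$, where $d$ is the number-of-divisors function. *)

theory Defs
  imports
    Complex_Main
    "HOL-Computational_Algebra.Primes"
    "HOL-Library.Infinite_Set"
begin

text \<open>Indexing starts at 1, so \<open>nth_prime 1 = 2\<close>; \<open>nth_prime 0\<close> is a junk value.\<close>

definition nth_prime :: "nat \<Rightarrow> nat" where
  "nth_prime i = enumerate {p. prime p} (i - 1)"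

definition divisor_count :: "nat \<Rightarrow> nat" where
  "divisor_count n = card {k. k dvd n}"

definition highly_composite :: "nat \<Rightarrow> bool" where
  "highly_composite N \<longleftrightarrow>
     N > 0 \<and> (\<forall>m. 0 < m \<and> m < N \<longrightarrow> divisor_count m < divisor_count N)"

definition B :: "nat \<Rightarrow> nat" where
  "B n = (\<Prod>i = 1..n. nth_prime i ^ (n div i))"

end

theory Submission
  imports Defs
begin

text \<open>
  In \<open>B n\<close> the exponents of 2 and 3 have ratio about 2, whereas the product of (exponent + 1)
  would favour a ratio near \<open>log 2 3 \<approx> 1.585\<close>. Trading \<open>2 ^ 8 = 256\<close> for the smaller
  \<open>3 ^ 5 = 243\<close> multiplies the divisor count by
  \<open>(n - 7) (\<lfloor>n/2\<rfloor> + 6) / ((n + 1) (\<lfloor>n/2\<rfloor> + 1))\<close>, which exceeds 1 for large \<open>n\<close>.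
\<close>

text \<open>Multiplication maps pairs of divisors bijectively onto the divisors of the product:
  coprimality of the crossed factors gives injectivity, splitting a divisor of \<open>a * b\<close>
  gives surjectivity.\<close>

lemma divisor_count_mult_coprime:
  assumes "coprime a b"
  shows "divisor_count (a * b) = divisor_count a * divisor_count b"
proof -
  have "bij_betw (\<lambda>(x, y). x * y) ({x. x dvd a} \<times> {y. y dvd b}) {k. k dvd a * b}"
  proof (rule bij_betwI')
    fix u v assume "u \<in> {x. x dvd a} \<times> {y. y dvd b}" "v \<in> {x. x dvd a} \<times> {y. y dvd b}"
    then obtain x y x' y' where uv: "u = (x, y)" "v = (x', y')"
      and dvd: "x dvd a" "y dvd b" "x' dvd a" "y' dvd b" by auto
    have cop: "coprime x y'" "coprime x' y"
      using assms dvd by (meson coprime_divisors)+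
    show "((case u of (x, y) \<Rightarrow> x * y) = (case v of (x, y) \<Rightarrow> x * y)) = (u = v)"
      using uv cop coprime_crossproduct_nat[of x y' x' y] by (auto simp: mult.commute)
  next
    fix u assume "u \<in> {x. x dvd a} \<times> {y. y dvd b}"
    then show "(case u of (x, y) \<Rightarrow> x * y) \<in> {k. k dvd a * b}"
      by (auto intro: mult_dvd_mono)
  next
    fix k assume "k \<in> {k. k dvd a * b}"
    then obtain x y where "k = x * y" "x dvd a" "y dvd b"
      using division_decomp[of k a b] by auto
    then show "\<exists>u\<in>{x. x dvd a} \<times> {y. y dvd b}. k = (case u of (x, y) \<Rightarrow> x * y)"
      by force
  qed
  then show ?thesis
    unfolding divisor_count_def by (metis bij_betw_same_card card_cartesian_product)
qed

lemma divisor_count_prime_power: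
  assumes "prime p"
  shows "divisor_count (p ^ a) = a + 1"
proof -
  have "{k. k dvd p ^ a} = (\<lambda>i. p ^ i) ` {..a}"
    using divides_primepow_nat[OF assms] by auto
  moreover have "inj_on (\<lambda>i. p ^ i) {..a}"
    using prime_gt_1_nat[OF assms] by (auto intro: inj_onI)
  ultimately show ?thesis
    by (simp add: divisor_count_def card_image)
qed

text \<open>The trade alters only the exponents of 2 and 3; the rest stays an opaque cofactor
  \<open>r\<close>, whose divisor count cancels in the comparison.\<close>

lemma divisor_count_2_3:
  assumes "coprime 2 r" "coprime 3 r"
  shows "divisor_count (2 ^ a * 3 ^ b * r) = (a + 1) * (b + 1) * divisor_count r"
proof -
  have "coprime (2 ^ a :: nat) (3 ^ b)"
    by (simp add: primes_coprime)
  moreover have "coprime (2 ^ a * 3 ^ b) r"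
    using assms by simp
  ultimately show ?thesis
    by (simp add: divisor_count_mult_coprime divisor_count_prime_power)
qed

lemma prime_nth_prime: "prime (nth_prime i)"
  using enumerate_in_set[OF primes_infinite] by (simp add: nth_prime_def)

lemma nth_prime_less: "1 \<le> i \<Longrightarrow> i < j \<Longrightarrow> nth_prime i < nth_prime j"
  by (simp add: nth_prime_def primes_infinite)

lemma nth_prime_1: "nth_prime 1 = 2"
  by (auto simp: nth_prime_def enumerate_0 intro!: Least_equality prime_ge_2_nat)

lemma nth_prime_2: "nth_prime 2 = 3"
proof -
  have "enumerate {p::nat. prime p} (Suc 0) = (LEAST s. s \<in> {p. prime p} \<and> 2 < s)"
    using enumerate_Suc''[OF primes_infinite, of 0] nth_prime_1
    by (simp add: nth_prime_def)
  also have "\<dots> = 3"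
    by (rule Least_equality) auto
  finally show ?thesis by (simp add: nth_prime_def)
qed

lemma B_eq:
  assumes "n \<ge> 2"
  obtains r where "B n = 2 ^ n * 3 ^ (n div 2) * r" "coprime 2 r" "coprime 3 r" "r > 0"
proof
  let ?r = "\<Prod>i = 3..n. nth_prime i ^ (n div i)"
  \<comment> \<open>All remaining primes exceed 3, hence differ from 2 and 3; coprimality
    follows.\<close>
  have gt: "nth_prime i > 3" if "i \<ge> 3" for i
    using nth_prime_less[of 2 i] that nth_prime_2 by simp
  show "B n = 2 ^ n * 3 ^ (n div 2) * ?r"
    using assms nth_prime_1 nth_prime_2
    by (simp add: B_def prod.atLeast_Suc_atMost numeral_eq_Suc)
  have "coprime p ?r" if "prime p" "p \<le> 3" for p
    using that
    by (intro prod_coprime_right) (auto intro!: primes_coprime prime_nth_prime dest: gt)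
  from this[of 2] this[of 3] show "coprime 2 ?r" "coprime 3 ?r"
    by simp_all
  show "?r > 0"
    by (auto intro!: prod_pos prime_gt_0_nat prime_nth_prime)
qed

lemma not_highly_composite_B:
  assumes "n \<ge> 45"
  shows "\<not> highly_composite (B n)"
proof
  assume hc: "highly_composite (B n)"
  have "n \<ge> 2" using assms by simp
  then obtain r where r: "B n = 2 ^ n * 3 ^ (n div 2) * r" "coprime 2 r" "coprime 3 r" "r > 0"
    by (rule B_eq)
  \<comment> \<open>\<open>s\<close> is the common part: \<open>B n\<close> is
    \<open>256 * s\<close> and the competitor \<open>m\<close> is \<open>243 * s\<close>, so
    \<open>s > 0\<close> makes \<open>m\<close> strictly smaller.\<close>
  define s where "s = 2 ^ (n - 8) * 3 ^ (n div 2) * r"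
  define m where "m = 2 ^ (n - 8) * 3 ^ (n div 2 + 5) * r"
  have "(2::nat) ^ n = 2 ^ (n - 8) * 2 ^ 8"
    using assms by (subst power_add[symmetric]) simp
  then have "B n = 256 * s"
    unfolding r(1) s_def by simp
  moreover have "m = 243 * s"
    unfolding m_def s_def by (simp add: power_add)
  moreover have "s > 0"
    using r(4) by (simp add: s_def)
  ultimately have "m < B n" "m > 0"
    by simp_all
  then have "divisor_count m < divisor_count (B n)"
    using hc by (simp add: highly_composite_def)
  then have less: "(n - 8 + 1) * (n div 2 + 5 + 1) < (n + 1) * (n div 2 + 1)"
    unfolding m_def r(1) divisor_count_2_3[OF r(2,3)]
    by (metis mult_less_cancel2)
  define b where "b = n div 2"
  have "b \<ge> 22" using assms by (simp add: b_def)
  \<comment> \<open>Shifting by 22 clears the truncated subtraction. For even \<open>n\<close>,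
    \<open>less\<close> becomes \<open>(2*c + 37) * (c + 28) < (2*c + 45) * (c + 23)\<close>, that
    is \<open>2*c + 1 < 0\<close>; odd \<open>n\<close> leaves more room.\<close>
  then obtain c where c: "b = c + 22" by (metis add.commute le_Suc_ex)
  consider "n = 2 * b" | "n = 2 * b + 1" unfolding b_def by linarith
  then show False
    using less unfolding b_def[symmetric] by cases (simp_all add: c algebra_simps)
qed

theorem proposition54:
  shows "finite {N \<in> B ` {1..}. highly_composite N}"
proof (rule finite_subset)
  \<comment> \<open>Any highly composite value must come from an index below 45; also admitting
    index 0 is harmless.\<close>
  show "{N \<in> B ` {1..}. highly_composite N} \<subseteq> B ` {..<45}"
    using not_highly_composite_B by (force simp: not_le)
qed simp

end
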